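(* There exists a consistent digital line segments system (CDS) $\{S(p,q)\}_{p,q\in\mathbb{Z}^2}$ that has the small Hausdorff distance property: there are constants $C>0$ and $D>0$ such that for all $p,q\in\mathbb{Z}^2$ with $|\overline{pq}|\ge D$ we have $H(\overline{pq},S(p,q))\le C\log|\overline{pq}|$; that is, $H(\overline{pq},S(p,q))=O(\log|\overline{pq}|)$.
   Context: The grid graph on $\mathbb{Z}^2$ joins two points by an edge iff they differ by $1$ in exactly one coordinate. A system of digital segments assigns to every $p,q\in\mathbb{Z}^2$ a set $S(p,q)$ with $\{p,q\}\subseteq S(p,q)\subseteq\mathbb{Z}^2$. It is a consistent digital line segments system (CDS) if it satisfies: (S1) for all $p,q$, $S(p,q)$ is the vertex set of a path from $p$ to $q$ in the grid graph; (S2) $S(p,q)=S(q,p)$ for all $p,q$; (S3) for all $p,q$ and every $r\in S(p,q)$, $S(p,r)\subseteq S(p,q)$; (S4) for all $p,q$ there is $r\in\mathbb{Z}^2$ with $r\notin S(p,q)$ and $S(p,q)\subseteq S(p,r)$; (S5) if $p,q$ lie on a common horizontal or vertical line, then $S(p,q)$ is contained in that line. Here $\overline{pq}$ denotes the Euclidean segment from $p$ to $q$, $|\overline{pq}|$ its Euclidean length, and $H(A,B)$ the Hausdorff distance between plane sets $A,B$. *)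

theory Defs
  imports "HOL-Analysis.Analysis" "Graph_Theory.Pair_Digraph" "Graph_Theory.Vertex_Walk"
begin

text \<open>
  An undirected graph is represented by the digraph that contains both orientations of each edge.
\<close>

definition grid_graph :: "(int \<times> int) pair_pre_digraph" where
  "grid_graph =
     \<lparr> pverts = UNIV,
       parcs = {((a, b), (c, d)). (\<bar>a - c\<bar> = 1 \<and> b = d) \<or> (a = c \<and> \<bar>b - d\<bar> = 1)} \<rparr>"

definition is_grid_path ::
    "int \<times> int \<Rightarrow> (int \<times> int) list \<Rightarrow> int \<times> int \<Rightarrow> bool" where
  "is_grid_path p w q \<longleftrightarrow> vpath w (with_proj grid_graph) \<and> hd w = p \<and> last w = q"

locale cds =
  fixes S :: "int \<times> int \<Rightarrow> int \<times> int \<Rightarrow> (int \<times> int) set"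
  assumes endpoints: "{p, q} \<subseteq> S p q"
    and S1: "\<exists>w. is_grid_path p w q \<and> S p q = set w"
    and S2: "S p q = S q p"
    and S3: "r \<in> S p q \<Longrightarrow> S p r \<subseteq> S p q"
    and S4: "\<exists>r. r \<notin> S p q \<and> S p q \<subseteq> S p r"
    and S5_vertical: "fst p = fst q \<Longrightarrow> S p q \<subseteq> {r. fst r = fst p}"
    and S5_horizontal: "snd p = snd q \<Longrightarrow> S p q \<subseteq> {r. snd r = snd p}"

text \<open>
  The product metric on \<^typ>\<open>real \<times> real\<close> is the Euclidean one.
\<close>

definition real_point :: "int \<times> int \<Rightarrow> real \<times> real" where
  "real_point p = (real_of_int (fst p), real_of_int (snd p))"

abbreviation euclidean_segment :: "int \<times> int \<Rightarrow> int \<times> int \<Rightarrow> (real \<times> real) set" where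
  "euclidean_segment p q \<equiv> closed_segment (real_point p) (real_point q)"

abbreviation euclidean_length :: "int \<times> int \<Rightarrow> int \<times> int \<Rightarrow> real" where
  "euclidean_length p q \<equiv> dist (real_point p) (real_point q)"

text \<open>
  Meaningful for nonempty bounded sets only; otherwise the real-valued suprema and
  \<^const>\<open>infdist\<close> may take arbitrary default values.
\<close>

definition hausdorff_distance :: "'a::metric_space set \<Rightarrow> 'a set \<Rightarrow> real" where
  "hausdorff_distance A B = max (SUP a\<in>A. infdist a B) (SUP b\<in>B. infdist b A)"

definition small_hausdorff_distance ::
    "(int \<times> int \<Rightarrow> int \<times> int \<Rightarrow> (int \<times> int) set) \<Rightarrow> bool" where
  "small_hausdorff_distance S \<longleftrightarrow>
     (\<exists>C>0. \<exists>D>0. \<forall>p q. euclidean_length p q \<ge> D \<longrightarrow>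
        hausdorff_distance (euclidean_segment p q) (real_point ` S p q)
          \<le> C * ln (euclidean_length p q))"

end

theory Submission
  imports Defs
begin

text \<open>
  Fix an injective key on the integers. A digital segment that rises from left to right visits the
  antidiagonals \<open>x + y = m\<close> one after the other and leaves the \<open>m\<close>-th one upwards exactly if the key
  of \<open>m\<close> reaches a threshold, which is chosen so that the path ends in the right point. Subpaths use
  the same threshold, whence consistency; falling segments are obtained by reflection.

  The key orders the integers lexicographically by their binary digits, least significant digit
  first (the van der Corput order). At each threshold at most one residue class modulo \<open>2 ^ k\<close>
  contains both keys below and keys above it, so the numbers of up-steps in two windows of length
  \<open>2 ^ k\<close> differ by at most 1. Cutting an interval of length \<open>n\<close> into windows according to the binary
  expansion of \<open>n\<close> shows that up-steps are uniformly distributed up to an error \<open>O(log n)\<close>.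
\<close>

section \<open>The van der Corput key of an integer\<close>

text \<open>
  The digits are those of the two's complement. They are weighted by powers of 3, as powers of 2
  would give 1 = 100\<open>\<dots>\<close> and -2 = 0111\<open>\<dots>\<close> the same key.
\<close>

definition digit_key :: "int \<Rightarrow> real" where
  "digit_key i = (\<Sum>n. real_of_int (i div 2 ^ n mod 2) / 3 ^ Suc n)"

lemma digit_bounds: "0 \<le> real_of_int (i div 2 ^ n mod 2)" "real_of_int (i div 2 ^ n mod 2) \<le> 1"
proof -
  have "0 \<le> j mod 2" "j mod 2 \<le> 1" for j :: int
    by presburger+
  from this[of "i div 2 ^ n"]
  show "0 \<le> real_of_int (i div 2 ^ n mod 2)" "real_of_int (i div 2 ^ n mod 2) \<le> 1"
    by linarith+
qed

lemma sums_inverse_powers_3: "(\<lambda>n. 1 / 3 ^ Suc n :: real) sums (1 / 2)"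
  using sums_mult[OF geometric_sums[of "1 / 3 :: real"], of "1 / 3"]
  by (simp add: power_one_over field_simps)

lemma summable_digit_key: "summable (\<lambda>n. real_of_int (i div 2 ^ n mod 2) / 3 ^ Suc n)"
proof (rule summable_comparison_test')
  show "summable (\<lambda>n. 1 / 3 ^ Suc n :: real)"
    using sums_inverse_powers_3 by (rule sums_summable)
  show "norm (real_of_int (i div 2 ^ n mod 2) / 3 ^ Suc n) \<le> 1 / 3 ^ Suc n" for n
    using digit_bounds[of i n] by (simp add: divide_right_mono)
qed

lemma digit_key_nonneg: "0 \<le> digit_key i"
  unfolding digit_key_def
  by (intro suminf_nonneg summable_digit_key divide_nonneg_pos digit_bounds) simp

text \<open>The point of the base 3: behind a leading digit the remaining ones contribute at most
  1/6, less than the 1/3 that the leading digit is worth. So keys with leading digit 0 and 1 are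
  separated by a gap.\<close>

lemma digit_key_le: "digit_key i \<le> 1 / 2"
proof -
  have "digit_key i \<le> (\<Sum>n. 1 / 3 ^ Suc n)"
    unfolding digit_key_def
    using sums_inverse_powers_3
    by (intro suminf_le summable_digit_key sums_summable[of _ "1 / 2"] divide_right_mono digit_bounds)
       simp_all
  then show ?thesis
    using sums_inverse_powers_3 by (simp add: sums_iff)
qed

lemma digit_key_rec: "digit_key i = (real_of_int (i mod 2) + digit_key (i div 2)) / 3"
proof -
  let ?f = "\<lambda>i n. real_of_int (i div 2 ^ n mod 2) / 3 ^ Suc n"
  have "digit_key i = suminf (\<lambda>n. ?f i (Suc n)) + ?f i 0"
    unfolding digit_key_def using suminf_split_head[OF summable_digit_key[of i]] by simp
  moreover have "?f i (Suc n) = ?f (i div 2) n / 3" for n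
    by (simp add: zdiv_zmult2_eq)
  moreover have "suminf (\<lambda>n. ?f (i div 2) n / 3) = suminf (?f (i div 2)) / 3"
    by (rule suminf_divide[OF summable_digit_key])
  ultimately show ?thesis
    by (simp add: digit_key_def field_simps)
qed

text \<open>By induction on the digits: different last digits put the keys into the disjoint
  intervals [0, 1/6] and [1/3, 1/2]; equal last digits are stripped off.\<close>

lemma digit_key_neq_if_mod_neq: "i mod 2 ^ k \<noteq> j mod 2 ^ k \<Longrightarrow> digit_key i \<noteq> digit_key j"
proof (induction k arbitrary: i j)
  case (Suc k)
  have split: "l mod 2 ^ Suc k = 2 * (l div 2 mod 2 ^ k) + l mod 2" for l :: int
    by (simp add: zmod_zmult2_eq)
  note keys = digit_key_rec[of i] digit_key_rec[of j]
    digit_key_nonneg[of "i div 2"] digit_key_le[of "i div 2"]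
    digit_key_nonneg[of "j div 2"] digit_key_le[of "j div 2"]
  show ?case
  proof (cases "i mod 2 = j mod 2")
    case True
    then have "i div 2 mod 2 ^ k \<noteq> j div 2 mod 2 ^ k"
      using Suc.prems unfolding split by simp
    from Suc.IH[OF this] show ?thesis
      using keys True by simp
  next
    case False
    then have "i mod 2 = 0 \<and> j mod 2 = 1 \<or> i mod 2 = 1 \<and> j mod 2 = 0"
      by presburger
    then show ?thesis
      using keys by auto
  qed
qed simp

text \<open>The lowest digit in which \<open>i\<close> and \<open>j\<close> differ is among the
  first \<open>k\<close>, and it decides the comparison. Those digits depend on the residue classes
  only, so distinct classes are ordered as blocks.\<close>

lemma digit_key_less_cong_mod:
  assumes "i mod 2 ^ k \<noteq> j mod 2 ^ k" "digit_key i < digit_key j"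
    and "i' mod 2 ^ k = i mod 2 ^ k" "j' mod 2 ^ k = j mod 2 ^ k"
  shows "digit_key i' < digit_key j'"
  using assms
proof (induction k arbitrary: i j i' j')
  case (Suc k)
  have split: "l mod 2 ^ Suc k = 2 * (l div 2 mod 2 ^ k) + l mod 2" for l :: int
    by (simp add: zmod_zmult2_eq)
  have cong: "l' mod 2 = l mod 2 \<and> l' div 2 mod 2 ^ k = l div 2 mod 2 ^ k"
    if "l' mod 2 ^ Suc k = l mod 2 ^ Suc k" for l l' :: int
  proof -
    have "l' mod 2 = l mod 2 \<and> x' = x" if "2 * x' + l' mod 2 = 2 * x + l mod 2" for x x' :: int
      using that by presburger
    then show ?thesis
      using that unfolding split by blast
  qed
  note i' = cong[OF Suc.prems(3)] and j' = cong[OF Suc.prems(4)]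
  show ?case
  proof (cases "i mod 2 = j mod 2")
    case True
    then have "i div 2 mod 2 ^ k \<noteq> j div 2 mod 2 ^ k"
      using Suc.prems(1) unfolding split by simp
    moreover have "digit_key (i div 2) < digit_key (j div 2)"
      using Suc.prems(2) unfolding digit_key_rec[of i] digit_key_rec[of j] True by simp
    ultimately have "digit_key (i' div 2) < digit_key (j' div 2)"
      using Suc.IH i' j' by blast
    moreover have "i' mod 2 = j' mod 2"
      using True i' j' by simp
    ultimately show ?thesis
      unfolding digit_key_rec[of i'] digit_key_rec[of j'] by simp
  next
    case False
    then consider "i mod 2 = 0" "j mod 2 = 1" | "i mod 2 = 1" "j mod 2 = 0"
      by fastforce
    then show ?thesis
    proof cases
      case 1
      then have "i' mod 2 = 0" "j' mod 2 = 1"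
        using i' j' by simp_all
      then show ?thesis
        using digit_key_le[of "i' div 2"] digit_key_nonneg[of "j' div 2"]
        unfolding digit_key_rec[of i'] digit_key_rec[of j'] by simp
    next
      case 2
      then have False
        using Suc.prems(2) digit_key_nonneg[of "i div 2"] digit_key_le[of "j div 2"]
        unfolding digit_key_rec[of i] digit_key_rec[of j] by simp
      then show ?thesis ..
    qed
  qed
qed simp

lemma inj_digit_key: "inj digit_key"
proof (rule injI, rule ccontr)
  fix i j assume eq: "digit_key i = digit_key j" and "i \<noteq> j"
  \<comment> \<open>Any exponent with \<bar>i - j\<bar> < 2 ^ k separates the two residues; \<bar>i
    - j\<bar> itself is large enough.\<close>
  define k where "k = nat \<bar>i - j\<bar>"
  have "\<bar>i - j\<bar> < 2 ^ k"
    using less_exp[of k] unfolding k_def by (metis abs_ge_zero nat_less_iff of_nat_numeral of_nat_power)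
  moreover have "i mod 2 ^ k \<noteq> j mod 2 ^ k"
  proof
    assume "i mod 2 ^ k = j mod 2 ^ k"
    then have "2 ^ k dvd i - j"
      by (simp add: mod_eq_dvd_iff)
    then show False
      using zdvd_imp_le[of "2 ^ k" "\<bar>i - j\<bar>"] \<open>i \<noteq> j\<close> \<open>\<bar>i - j\<bar> < 2 ^ k\<close> by simp
  qed
  ultimately show False
    using digit_key_neq_if_mod_neq eq by blast
qed

section \<open>Counting up-steps at a threshold\<close>

text \<open>The height that a path with threshold \<theta> gains between the antidiagonals
  \<open>a\<close> and \<open>b\<close>. The interval is half-open because the key of an
  antidiagonal governs the step that leaves it.\<close>

definition up_count :: "real \<Rightarrow> int \<Rightarrow> int \<Rightarrow> int" where
  "up_count \<theta> a b = int (card {i \<in> {a..<b}. \<theta> \<le> digit_key i})"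

lemma up_count_nonneg: "0 \<le> up_count \<theta> a b"
  by (simp add: up_count_def)

lemma up_count_le: "a \<le> b \<Longrightarrow> up_count \<theta> a b \<le> b - a"
  unfolding up_count_def
  using card_mono[of "{a..<b}" "{i \<in> {a..<b}. \<theta> \<le> digit_key i}", OF finite_atLeastLessThan_int]
  by (simp add: subset_iff)

lemma up_count_self [simp]: "up_count \<theta> a a = 0"
  by (simp add: up_count_def)

lemma up_count_split:
  assumes "a \<le> m" "m \<le> b"
  shows "up_count \<theta> a b = up_count \<theta> a m + up_count \<theta> m b"
proof -
  have "{i \<in> {a..<b}. \<theta> \<le> digit_key i} =
      {i \<in> {a..<m}. \<theta> \<le> digit_key i} \<union> {i \<in> {m..<b}. \<theta> \<le> digit_key i}"
    using assms by auto
  moreover have "card ({i \<in> {a..<m}. \<theta> \<le> digit_key i} \<union> {i \<in> {m..<b}. \<theta> \<le> digit_key i}) =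
      card {i \<in> {a..<m}. \<theta> \<le> digit_key i} + card {i \<in> {m..<b}. \<theta> \<le> digit_key i}"
    by (rule card_Un_disjoint; (rule finite_subset[OF _ finite_atLeastLessThan_int])?) auto
  ultimately show ?thesis
    by (simp only: up_count_def of_nat_add)
qed

lemma up_count_step: "up_count \<theta> a (a + 1) = (if \<theta> \<le> digit_key a then 1 else 0)"
proof -
  have "{i \<in> {a..<a + 1}. \<theta> \<le> digit_key i} = (if \<theta> \<le> digit_key a then {a} else {})"
    by auto
  then show ?thesis
    by (simp add: up_count_def)
qed

text \<open>Makes thresholds comparable: of two paths from one point, that with the lower threshold
  never gains less height.\<close>

lemma up_count_antimono: "\<theta> \<le> \<theta>' \<Longrightarrow> up_count \<theta>' a b \<le> up_count \<theta> a b"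
  unfolding up_count_def
  by (intro of_nat_mono card_mono finite_subset[OF _ finite_atLeastLessThan_int[of a b]]) auto

text \<open>Passing to another threshold changes both parts in the same direction, so an unchanged
  total forces both parts to be unchanged. Hence it does not matter which threshold reaches a given
  endpoint.\<close>

lemma up_count_prefix_eq:
  assumes "a \<le> m" "m \<le> b" "up_count \<theta> a b = up_count \<theta>' a b"
  shows "up_count \<theta> a m = up_count \<theta>' a m" "up_count \<theta> m b = up_count \<theta>' m b"
proof -
  have "up_count \<theta> a m \<le> up_count \<theta>' a m \<and> up_count \<theta> m b \<le> up_count \<theta>' m b
      \<or> up_count \<theta>' a m \<le> up_count \<theta> a m \<and> up_count \<theta>' m b \<le> up_count \<theta> m b"
    using up_count_antimono linear[of \<theta> \<theta>'] by blast
  then show "up_count \<theta> a m = up_count \<theta>' a m" "up_count \<theta> m b = up_count \<theta>' m b"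
    using assms up_count_split[OF assms(1,2), of \<theta>] up_count_split[OF assms(1,2), of \<theta>'] by linarith+
qed

text \<open>All keys lie in [0, 1/2], so the thresholds 0 and 1 produce purely vertical and purely
  horizontal paths.\<close>

lemma up_count_0: "a \<le> b \<Longrightarrow> up_count 0 a b = b - a"
  by (simp add: up_count_def digit_key_nonneg Collect_conj_eq[symmetric] del: mem_Collect_eq
      flip: atLeastLessThan_iff)

lemma up_count_1: "up_count 1 a b = 0"
proof -
  have "{i \<in> {a..<b}. 1 \<le> digit_key i} = {}"
    using digit_key_le by (auto simp: not_le intro: le_less_trans[where y = "1 / 2"])
  then show ?thesis
    by (simp only: up_count_def card.empty of_nat_0)
qed

text \<open>Start with a threshold above all values and lower it repeatedly to the largest value
  still below it; by injectivity exactly one element enters each time.\<close>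

lemma ex_threshold_card:
  fixes f :: "'a \<Rightarrow> 'b::{linorder,no_top}"
  assumes "finite A" "inj_on f A" "k \<le> card A"
  shows "\<exists>\<theta>. card {i \<in> A. \<theta> \<le> f i} = k"
  using assms(3)
proof (induction k)
  case 0
  obtain \<theta> where "\<forall>i\<in>A. f i < \<theta>"
  proof (cases "A = {}")
    case False
    obtain \<theta> where "Max (f ` A) < \<theta>"
      using gt_ex by blast
    then show thesis
      using that assms(1) False by simp
  qed (use that in blast)
  then have "{i \<in> A. \<theta> \<le> f i} = {}"
    by auto
  then show ?case
    by (metis card.empty)
next
  case (Suc k)
  then obtain \<theta> where \<theta>: "card {i \<in> A. \<theta> \<le> f i} = k"
    by auto
  let ?B = "{i \<in> A. f i < \<theta>}"
  have "?B \<noteq> {}"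
  proof
    assume "?B = {}"
    then have "{i \<in> A. \<theta> \<le> f i} = A"
      by (auto simp: not_less)
    then show False
      using \<theta> Suc.prems by simp
  qed
  then have max: "Max (f ` ?B) \<in> f ` ?B"
    using assms(1) by (intro Max_in) auto
  then obtain m where m: "m \<in> ?B" "f m = Max (f ` ?B)"
    by auto
  have "f i \<le> f m" if "i \<in> ?B" for i
    using assms(1) m(2) that by simp
  then have "{i \<in> A. f m \<le> f i} = insert m {i \<in> A. \<theta> \<le> f i}"
    using m(1) inj_onD[OF assms(2)] by (force simp: not_le dest: order.antisym)
  moreover have "m \<notin> {i \<in> A. \<theta> \<le> f i}"
    using m(1) by auto
  ultimately show ?case
    using assms(1) \<theta> by (intro exI[of _ "f m"]) simp
qed

lemma ex_up_count:
  assumes "0 \<le> k" "k \<le> b - a"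
  shows "\<exists>\<theta>. up_count \<theta> a b = k"
proof -
  have "\<exists>\<theta>. card {i \<in> {a..<b}. \<theta> \<le> digit_key i} = nat k"
    using assms inj_digit_key by (intro ex_threshold_card) (auto intro: inj_on_subset)
  then show ?thesis
    using assms(1) unfolding up_count_def by (metis int_nat_eq)
qed

section \<open>Uniform distribution of up-steps\<close>

lemma bij_betw_mod_window:
  fixes a n :: int
  assumes "0 < n"
  shows "bij_betw (\<lambda>i. i mod n) {a..<a + n} {0..<n}"
proof -
  have inj: "inj_on (\<lambda>i. i mod n) {a..<a + n}"
  proof
    fix i j assume ij: "i \<in> {a..<a + n}" "j \<in> {a..<a + n}" "i mod n = j mod n"
    then have "n dvd i - j"
      by (simp add: mod_eq_dvd_iff)
    then show "i = j"
      using zdvd_imp_le[of n "\<bar>i - j\<bar>"] ij(1,2) by (cases "i = j") auto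
  qed
  moreover have "(\<lambda>i. i mod n) ` {a..<a + n} = {0..<n}"
    using assms by (intro card_subset_eq) (auto simp: card_image[OF inj])
  ultimately show ?thesis
    by (simp add: bij_betw_def)
qed

text \<open>Each window of length 2 ^ k meets every residue class exactly once, so up-steps in
  different windows can be compared through their residues.\<close>

lemma up_count_window_le:
  "up_count \<theta> a (a + 2 ^ k) \<le> up_count \<theta> b (b + 2 ^ k) + 1"
proof -
  let ?n = "2 ^ k :: int"
  let ?R = "\<lambda>a. (\<lambda>i. i mod ?n) ` {i \<in> {a..<a + ?n}. \<theta> \<le> digit_key i}"
  have card: "card (?R a) = card {i \<in> {a..<a + ?n}. \<theta> \<le> digit_key i}" for a
    using bij_betw_mod_window[of ?n a]
    by (intro card_image inj_on_subset[where B = "{i \<in> {a..<a + ?n}. \<theta> \<le> digit_key i}" and A = "{a..<a + ?n}"])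
       (auto simp: bij_betw_def)
  \<comment> \<open>A class that meets the up-steps in one window but not in the other contains keys on both
    sides of the threshold, and two distinct classes are separated by their keys.\<close>
  have uniq: "x = y" if xy: "x \<in> ?R a - ?R b" "y \<in> ?R a - ?R b" for x y
  proof (rule ccontr)
    assume "x \<noteq> y"
    have *: "\<exists>i j. i mod ?n = x \<and> j mod ?n = x \<and> \<theta> \<le> digit_key i \<and> digit_key j < \<theta>"
      if "x \<in> ?R a - ?R b" for x
    proof -
      from that obtain i where i: "i mod ?n = x" "\<theta> \<le> digit_key i"
        by auto
      then have "x \<in> {0..<?n}"
        by auto
      then obtain j where j: "j \<in> {b..<b + ?n}" "j mod ?n = x"
        using bij_betw_mod_window[of ?n b]
        unfolding bij_betw_def by (metis (no_types, lifting) imageE zero_less_numeral zero_less_power)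
      with that have "digit_key j < \<theta>"
        by (auto simp: not_le[symmetric])
      then show ?thesis
        using i j by blast
    qed
    obtain i j where ij: "i mod ?n = x" "j mod ?n = x" "\<theta> \<le> digit_key i" "digit_key j < \<theta>"
      using *[OF xy(1)] by blast
    obtain i' j' where ij': "i' mod ?n = y" "j' mod ?n = y" "\<theta> \<le> digit_key i'" "digit_key j' < \<theta>"
      using *[OF xy(2)] by blast
    \<comment> \<open>The first inequality puts the class \<open>y\<close> below the class
      \<open>x\<close>. Applied to the representatives \<open>i'\<close> of \<open>y\<close> and
      \<open>j\<close> of \<open>x\<close>, this contradicts the second inequality.\<close>
    have "digit_key j' < digit_key i" "digit_key j < digit_key i'"
      using ij ij' by linarith+
    with digit_key_less_cong_mod[of j' k i i' j] ij ij' \<open>x \<noteq> y\<close> show False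
      by auto
  qed
  have fin: "finite (?R a)" for a
    by (rule finite_imageI, rule finite_subset[of _ "{a..<a + ?n}"]) auto
  have "card (?R a - ?R b) \<le> 1"
    unfolding One_nat_def card_le_Suc0_iff_eq[OF finite_Diff[OF fin]] using uniq by blast
  moreover have "card (?R a) \<le> card (?R a - ?R b) + card (?R b)"
  proof -
    have "card (?R a) \<le> card ((?R a - ?R b) \<union> ?R b)"
      by (rule card_mono) (use fin in blast)+
    then show ?thesis
      using card_Un_le order.trans by blast
  qed
  ultimately show ?thesis
    unfolding card up_count_def by linarith
qed

lemma up_count_windows:
  assumes "\<And>a. l \<le> up_count \<theta> a (a + 2 ^ k)" "\<And>a. up_count \<theta> a (a + 2 ^ k) \<le> u"
  shows "2 ^ j * l \<le> up_count \<theta> a (a + 2 ^ (k + j))" "up_count \<theta> a (a + 2 ^ (k + j)) \<le> 2 ^ j * u"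
proof (induction j arbitrary: a)
  case (Suc j)
  have split: "up_count \<theta> a (a + 2 ^ (k + Suc j)) =
      up_count \<theta> a (a + 2 ^ (k + j)) + up_count \<theta> (a + 2 ^ (k + j)) (a + 2 ^ (k + j) + 2 ^ (k + j))" for a
    using up_count_split[of a "a + 2 ^ (k + j)" "a + 2 ^ (k + Suc j)" \<theta>]
    by (simp add: algebra_simps)
  { case 1 show ?case unfolding split using Suc(1)[of a] Suc(1)[of "a + 2 ^ (k + j)"] by simp }
  { case 2 show ?case unfolding split using Suc(2)[of a] Suc(2)[of "a + 2 ^ (k + j)"] by simp }
qed (use assms in simp_all)

text \<open>All windows of length 2 ^ k contain \<open>M\<close> or \<open>M + 1\<close> up-steps,
  where \<open>M\<close> is the minimum. The windows that tile [0, 2 ^ K) then have an average in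
  the same unit interval, and this average is the density times 2 ^ k.\<close>

lemma up_count_window_density:
  assumes "k \<le> K"
  shows "\<bar>up_count \<theta> a (a + 2 ^ k) - up_count \<theta> 0 (2 ^ K) / 2 ^ K * 2 ^ k\<bar> \<le> 1"
proof -
  \<comment> \<open>The minimum over infinitely many windows is attained because the counts are
    natural numbers.\<close>
  obtain b where b: "\<And>a. up_count \<theta> b (b + 2 ^ k) \<le> up_count \<theta> a (a + 2 ^ k)"
  proof -
    obtain b where "is_arg_min (\<lambda>b. nat (up_count \<theta> b (b + 2 ^ k))) (\<lambda>_. True) b"
      using ex_is_arg_min_if_finite is_arg_min_arg_min_nat[of "\<lambda>_. True"] by blast
    then show thesis
      using that up_count_nonneg by (auto simp: is_arg_min_linorder nat_le_eq_zle)
  qed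
  define M where "M = up_count \<theta> b (b + 2 ^ k)"
  obtain j where K: "K = k + j"
    using assms le_Suc_ex by blast
  have lo: "M \<le> up_count \<theta> a (a + 2 ^ k)" and hi: "up_count \<theta> a (a + 2 ^ k) \<le> M + 1" for a
    using b[of a] up_count_window_le[of \<theta> a k b] by (simp_all add: M_def)
  have "2 ^ j * M \<le> up_count \<theta> 0 (2 ^ K)" "up_count \<theta> 0 (2 ^ K) \<le> 2 ^ j * (M + 1)"
    using up_count_windows[where l = M and u = "M + 1" and a = 0 and j = j, OF lo hi] by (simp_all add: K)
  then have "real_of_int (2 ^ j * M) \<le> up_count \<theta> 0 (2 ^ K)"
    "up_count \<theta> 0 (2 ^ K) \<le> real_of_int (2 ^ j * (M + 1))"
    by (simp_all only: of_int_le_iff)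
  moreover have "up_count \<theta> 0 (2 ^ K) / 2 ^ K * 2 ^ k = up_count \<theta> 0 (2 ^ K) / 2 ^ j"
    by (simp add: K power_add)
  ultimately have "M \<le> up_count \<theta> 0 (2 ^ K) / 2 ^ K * 2 ^ k" "up_count \<theta> 0 (2 ^ K) / 2 ^ K * 2 ^ k \<le> M + 1"
    by (simp_all only:) (simp_all add: field_simps)
  then show ?thesis
    using lo[of a] hi[of a] by linarith
qed

text \<open>Splitting off the window for the leading binary digit of \<open>m\<close> costs an error
  of at most 1 per digit. \<open>K\<close> stays fixed in the induction so that all pieces are
  measured against one density.\<close>

lemma up_count_density:
  assumes "k \<le> K" "0 \<le> m" "m < 2 ^ k"
  shows "\<bar>up_count \<theta> a (a + m) - up_count \<theta> 0 (2 ^ K) / 2 ^ K * m\<bar> \<le> k"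
  using assms
proof (induction k arbitrary: a m)
  case 0
  then have "m = 0"
    by simp
  then show ?case
    by simp
next
  case (Suc k)
  let ?d = "up_count \<theta> 0 (2 ^ K) / 2 ^ K"
  show ?case
  proof (cases "m < 2 ^ k")
    case True
    then show ?thesis
      using Suc.IH[of m a] Suc.prems by simp
  next
    case False
    define m' where "m' = m - 2 ^ k"
    have m': "m = 2 ^ k + m'" "0 \<le> m'" "m' < 2 ^ k"
      using False Suc.prems by (simp_all add: m'_def)
    have split: "up_count \<theta> a (a + m) = up_count \<theta> a (a + 2 ^ k) + up_count \<theta> (a + 2 ^ k) (a + 2 ^ k + m')"
      using up_count_split[of a "a + 2 ^ k" "a + m" \<theta>] m' by (simp add: add.assoc)
    have 1: "\<bar>up_count \<theta> (a + 2 ^ k) (a + 2 ^ k + m') - ?d * m'\<bar> \<le> k"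
      using Suc.IH[of m' "a + 2 ^ k"] m' Suc.prems by simp
    have 2: "\<bar>up_count \<theta> a (a + 2 ^ k) - ?d * 2 ^ k\<bar> \<le> 1"
      using up_count_window_density[of k K \<theta> a] Suc.prems by simp
    have 3: "?d * m = ?d * 2 ^ k + ?d * m'"
      by (simp add: m'(1) distrib_left)
    show ?thesis
      unfolding split 3 using 1 2 by simp
  qed
qed

text \<open>Both counts are within \<open>K\<close> of the common density; the error of the second
  is scaled by m / n \<le> 1.\<close>

lemma up_count_discrepancy:
  assumes "0 \<le> m" "m \<le> n" "0 < n" "n < 2 ^ K"
  shows "\<bar>up_count \<theta> a (a + m) - m / n * up_count \<theta> a (a + n)\<bar> \<le> 2 * K"
proof -
  let ?d = "up_count \<theta> 0 (2 ^ K) / 2 ^ K"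
  have m: "\<bar>up_count \<theta> a (a + m) - ?d * m\<bar> \<le> K"
    and n: "\<bar>up_count \<theta> a (a + n) - ?d * n\<bar> \<le> K"
    using up_count_density[of K K] assms by simp_all
  have "\<bar>m / n * up_count \<theta> a (a + n) - ?d * m\<bar> = m / n * \<bar>up_count \<theta> a (a + n) - ?d * n\<bar>"
  proof -
    have "m / n * up_count \<theta> a (a + n) - ?d * m = m / n * (up_count \<theta> a (a + n) - ?d * n)"
      using assms by (simp add: right_diff_distrib)
    then show ?thesis
      using assms by (simp add: abs_mult)
  qed
  also have "\<dots> \<le> 1 * real K"
    using assms n by (intro mult_mono) simp_all
  finally have "\<bar>m / n * up_count \<theta> a (a + n) - ?d * m\<bar> \<le> K"
    by simp
  moreover have "\<bar>x - z\<bar> \<le> \<bar>z - w\<bar> + \<bar>x - w\<bar>" for x z w :: real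
    by linarith
  ultimately show ?thesis
    using m by (smt (verit, best))
qed

section \<open>Rising segments\<close>

abbreviation level :: "int \<times> int \<Rightarrow> int" where
  "level p \<equiv> fst p + snd p"

abbreviation below :: "int \<times> int \<Rightarrow> int \<times> int \<Rightarrow> bool" where
  "below p q \<equiv> fst p \<le> fst q \<and> snd p \<le> snd q"

text \<open>No threshold is selected, since all those leading from \<open>p\<close> to
  \<open>q\<close> trace the same points. The set is empty unless \<open>below p q\<close>, which
  permits taking unions over all orientations later.\<close>

definition rising_segment :: "int \<times> int \<Rightarrow> int \<times> int \<Rightarrow> (int \<times> int) set" where
  "rising_segment p q = {r. level p \<le> level r \<and> level r \<le> level q \<and>
     (\<exists>\<theta>. snd r = snd p + up_count \<theta> (level p) (level r) \<and>
          snd q = snd r + up_count \<theta> (level r) (level q))}"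

lemma rising_segmentE:
  assumes "r \<in> rising_segment p q"
  obtains \<theta> where "level p \<le> level r" "level r \<le> level q"
    "snd r = snd p + up_count \<theta> (level p) (level r)"
    "snd q = snd r + up_count \<theta> (level r) (level q)"
    "snd q = snd p + up_count \<theta> (level p) (level q)"
proof -
  from assms obtain \<theta> where *: "level p \<le> level r" "level r \<le> level q"
    "snd r = snd p + up_count \<theta> (level p) (level r)"
    "snd q = snd r + up_count \<theta> (level r) (level q)"
    unfolding rising_segment_def by blast
  with up_count_split[OF *(1,2), of \<theta>] that show thesis
    by simp
qed

lemma rising_segment_below:
  assumes "r \<in> rising_segment p q"
  shows "below p r" "below r q"
proof -
  obtain \<theta> where "level p \<le> level r" "level r \<le> level q"
    "snd r = snd p + up_count \<theta> (level p) (level r)"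
    "snd q = snd r + up_count \<theta> (level r) (level q)"
    using assms by (rule rising_segmentE)
  then show "below p r" "below r q"
    using up_count_nonneg[of \<theta>] up_count_le[of "level p" "level r" \<theta>]
      up_count_le[of "level r" "level q" \<theta>] by (smt (verit))+
qed

lemma rising_segment_threshold:
  assumes "below p q"
  obtains \<theta> where "snd q = snd p + up_count \<theta> (level p) (level q)"
proof -
  obtain \<theta> where "up_count \<theta> (level p) (level q) = snd q - snd p"
    using ex_up_count[of "snd q - snd p" "level q" "level p"] assms by auto
  then show thesis
    by (intro that[of \<theta>]) simp
qed

text \<open>Allows working with one fixed threshold: the one hidden in the definition may differ,
  but has the same prefix counts by \<open>up_count_prefix_eq\<close>.\<close>

lemma rising_segment_iff:
  assumes "snd q = snd p + up_count \<theta> (level p) (level q)"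
  shows "r \<in> rising_segment p q \<longleftrightarrow> level p \<le> level r \<and> level r \<le> level q \<and>
    snd r = snd p + up_count \<theta> (level p) (level r)"
proof
  assume "r \<in> rising_segment p q"
  then obtain \<eta> where r: "level p \<le> level r" "level r \<le> level q"
    "snd r = snd p + up_count \<eta> (level p) (level r)"
    "snd q = snd p + up_count \<eta> (level p) (level q)"
    by (rule rising_segmentE)
  have "up_count \<eta> (level p) (level q) = up_count \<theta> (level p) (level q)"
    using r(4) assms by linarith
  from up_count_prefix_eq(1)[OF r(1,2) this] r
  show "level p \<le> level r \<and> level r \<le> level q \<and> snd r = snd p + up_count \<theta> (level p) (level r)"
    by simp
next
  assume r: "level p \<le> level r \<and> level r \<le> level q \<and>
    snd r = snd p + up_count \<theta> (level p) (level r)"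
  then have "snd q = snd r + up_count \<theta> (level r) (level q)"
    using up_count_split[of "level p" "level r" "level q" \<theta>] assms by simp
  with r show "r \<in> rising_segment p q"
    unfolding rising_segment_def by blast
qed

text \<open>A threshold that leads from \<open>p\<close> through \<open>r\<close> to
  \<open>q\<close> also serves the pair \<open>p\<close>, \<open>r\<close>, so both segments take
  the same steps. The suffix version rests on the same remark.\<close>

lemma rising_segment_prefix:
  assumes "r \<in> rising_segment p q"
  shows "rising_segment p r \<subseteq> rising_segment p q"
proof
  fix r' assume r': "r' \<in> rising_segment p r"
  obtain \<theta> where \<theta>: "level r \<le> level q" "snd r = snd p + up_count \<theta> (level p) (level r)"
    "snd q = snd p + up_count \<theta> (level p) (level q)"
    using assms by (rule rising_segmentE)
  with r' show "r' \<in> rising_segment p q"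
    by (auto simp: rising_segment_iff[OF \<theta>(2)] rising_segment_iff[OF \<theta>(3)])
qed

lemma rising_segment_suffix:
  assumes "r \<in> rising_segment p q"
  shows "rising_segment r q \<subseteq> rising_segment p q"
proof
  fix r' assume r': "r' \<in> rising_segment r q"
  obtain \<theta> where \<theta>: "level p \<le> level r" "snd r = snd p + up_count \<theta> (level p) (level r)"
    "snd q = snd r + up_count \<theta> (level r) (level q)"
    "snd q = snd p + up_count \<theta> (level p) (level q)"
    using assms by (rule rising_segmentE)
  with r' show "r' \<in> rising_segment p q"
    using up_count_split[of "level p" "level r" "level r'" \<theta>]
    by (auto simp: rising_segment_iff[OF \<theta>(3)] rising_segment_iff[OF \<theta>(4)])
qed

lemma rising_segment_endpoints:
  assumes "below p q"
  shows "p \<in> rising_segment p q" "q \<in> rising_segment p q"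
proof -
  obtain \<theta> where \<theta>: "snd q = snd p + up_count \<theta> (level p) (level q)"
    using rising_segment_threshold[OF assms] .
  show "p \<in> rising_segment p q" "q \<in> rising_segment p q"
    using assms \<theta> by (auto simp: rising_segment_iff[OF \<theta>])
qed

text \<open>On axis-parallel lines a segment is both rising and falling; this lemma and the next
  make the two versions agree.\<close>

lemma rising_segment_vertical:
  assumes "fst p = fst r" "fst r = fst q" "snd p \<le> snd r" "snd r \<le> snd q"
  shows "r \<in> rising_segment p q"
  unfolding rising_segment_def using assms by (auto simp: up_count_0 intro!: exI[of _ 0])

lemma rising_segment_horizontal:
  assumes "snd p = snd r" "snd r = snd q" "fst p \<le> fst r" "fst r \<le> fst q"
  shows "r \<in> rising_segment p q"
  unfolding rising_segment_def using assms by (auto simp: up_count_1 intro!: exI[of _ 1])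

text \<open>Keep the threshold and take one more step. The new point is not on the old segment
  because its antidiagonal lies beyond that of \<open>q\<close>.\<close>

lemma rising_segment_extend_end:
  assumes "below p q"
  obtains r where "r \<notin> rising_segment p q" "q \<in> rising_segment p r"
proof -
  obtain \<theta> where \<theta>: "snd q = snd p + up_count \<theta> (level p) (level q)"
    using rising_segment_threshold[OF assms] .
  define r where "r = (if \<theta> \<le> digit_key (level q) then (fst q, snd q + 1) else (fst q + 1, snd q))"
  have level: "level r = level q + 1"
    by (simp add: r_def)
  have "snd r = snd q + up_count \<theta> (level q) (level r)"
    unfolding level up_count_step by (simp add: r_def)
  then have "q \<in> rising_segment p r"
    unfolding rising_segment_def mem_Collect_eq using \<theta> assms level
    by (intro conjI exI[of _ \<theta>]) linarith+
  moreover have "r \<notin> rising_segment p q"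
    using rising_segment_below(2)[of r p q] level by auto
  ultimately show thesis
    using that by blast
qed

lemma rising_segment_extend_start:
  assumes "below p q"
  obtains r where "r \<notin> rising_segment p q" "p \<in> rising_segment r q"
proof -
  obtain \<theta> where \<theta>: "snd q = snd p + up_count \<theta> (level p) (level q)"
    using rising_segment_threshold[OF assms] .
  \<comment> \<open>The step into \<open>p\<close> leaves the antidiagonal before it, so the key of
    \<open>level p - 1\<close> decides where it comes from.\<close>
  define r where "r = (if \<theta> \<le> digit_key (level p - 1) then (fst p, snd p - 1) else (fst p - 1, snd p))"
  have level: "level p = level r + 1"
    by (simp add: r_def)
  have "up_count \<theta> (level r) (level p) = (if \<theta> \<le> digit_key (level p - 1) then 1 else 0)"
    unfolding level by (simp only: up_count_step add_diff_cancel_right')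
  then have "snd p = snd r + up_count \<theta> (level r) (level p)"
    by (simp only:) (simp add: r_def)
  then have "p \<in> rising_segment r q"
    unfolding rising_segment_def mem_Collect_eq using \<theta> assms level
    by (intro conjI exI[of _ \<theta>]) linarith+
  moreover have "r \<notin> rising_segment p q"
    using rising_segment_below(1)[of r p q] level by auto
  ultimately show thesis
    using that by blast
qed

section \<open>Rising segments as grid paths\<close>

lemma is_grid_path_iff:
  "is_grid_path p w q \<longleftrightarrow> w \<noteq> [] \<and> distinct w \<and> hd w = p \<and> last w = q \<and>
     successively (\<lambda>x y. (x, y) \<in> parcs grid_graph) w"
proof -
  have "set (vwalk_arcs w) \<subseteq> E \<longleftrightarrow> successively (\<lambda>x y. (x, y) \<in> E) w" for E :: "((int \<times> int) \<times> (int \<times> int)) set"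
    by (induction w rule: vwalk_arcs.induct) auto
  moreover have "arcs_ends (with_proj grid_graph) = parcs grid_graph"
    by (simp add: arcs_ends_def arc_to_ends_def)
  ultimately show ?thesis
    by (auto simp: is_grid_path_def vpath_def vwalk_def grid_graph_def)
qed

lemma is_grid_path_rev: "is_grid_path p w q \<Longrightarrow> is_grid_path q (rev w) p"
  unfolding is_grid_path_iff
  by (auto simp: hd_rev last_rev grid_graph_def abs_minus_commute elim!: successively_mono)

lemma successively_upto: "successively (\<lambda>x y. y = x + 1) [a..b]"
proof (induction a b rule: upto.induct)
  case (1 a b)
  consider "b < a" | "a = b" | "a < b"
    by linarith
  then show ?case
  proof cases
    case 3
    then show ?thesis
      using 1 by (simp add: upto_rec1[of a b] upto_rec1[of "a + 1" b])
  qed simp_all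
qed

lemma rising_segment_path:
  assumes "below p q"
  shows "\<exists>w. is_grid_path p w q \<and> rising_segment p q = set w"
proof -
  obtain \<theta> where \<theta>: "snd q = snd p + up_count \<theta> (level p) (level q)"
    using rising_segment_threshold[OF assms] .
  define y where "y m = snd p + up_count \<theta> (level p) m" for m
  \<comment> \<open>One point per antidiagonal: the second coordinate is the height reached there,
    the first is what remains of the level. This also makes the list distinct.\<close>
  define w where "w = map (\<lambda>m. (m - y m, y m)) [level p..level q]"
  have le: "level p \<le> level q"
    using assms by simp
  have "(((m - y m, y m), (m + 1 - y (m + 1), y (m + 1))) \<in> parcs grid_graph)" if "level p \<le> m" for m
    using up_count_split[of "level p" m "m + 1" \<theta>] that
    by (simp add: grid_graph_def y_def up_count_step)
  then have "successively (\<lambda>x y. (x, y) \<in> parcs grid_graph) w"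
    unfolding w_def successively_map by (intro successively_mono[OF successively_upto]) auto
  moreover have "distinct w"
    unfolding w_def distinct_map by (auto intro!: inj_onI)
  moreover have "w \<noteq> [] \<and> hd w = p \<and> last w = q"
  proof -
    have "[level p..level q] \<noteq> []" "hd [level p..level q] = level p" "last [level p..level q] = level q"
      using upto_rec1[OF le] upto_rec2[OF le] by (metis list.distinct(1), metis list.sel(1), metis last_snoc)
    moreover have "y (level p) = snd p" "y (level q) = snd q"
      using \<theta> by (simp_all only: y_def up_count_self add_0_right)
    ultimately show ?thesis
      by (simp add: w_def hd_map last_map)
  qed
  ultimately have "is_grid_path p w q"
    by (simp add: is_grid_path_iff)
  moreover have "rising_segment p q = set w"
  proof (intro set_eqI iffI)
    fix r assume "r \<in> rising_segment p q"
    then have "level r \<in> {level p..level q}" "r = (level r - y (level r), y (level r))"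
      by (simp_all add: rising_segment_iff[OF \<theta>] y_def prod_eq_iff)
    then show "r \<in> set w"
      unfolding w_def set_map set_upto by blast
  next
    fix r assume "r \<in> set w"
    then show "r \<in> rising_segment p q"
      unfolding w_def by (auto simp: rising_segment_iff[OF \<theta>] y_def)
  qed
  ultimately show ?thesis
    by blast
qed

section \<open>Reflection and the full system\<close>

definition mirror :: "int \<times> int \<Rightarrow> int \<times> int" where
  "mirror p = (- fst p, snd p)"

lemma mirror_simps [simp]:
  "fst (mirror p) = - fst p" "snd (mirror p) = snd p" "mirror (mirror p) = p"
  by (simp_all add: mirror_def)

lemma mem_mirror_image: "r \<in> mirror ` A \<longleftrightarrow> mirror r \<in> A"
  by (metis (no_types, lifting) image_iff mirror_simps(3))

lemma mirror_image_subset_iff: "mirror ` A \<subseteq> mirror ` B \<longleftrightarrow> A \<subseteq> B"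
  by (rule inj_image_subset_iff) (rule inj_on_inverseI[of _ mirror], simp)

lemma is_grid_path_mirror:
  assumes "is_grid_path p w q"
  shows "is_grid_path (mirror p) (map mirror w) (mirror q)"
proof -
  have "(mirror x, mirror y) \<in> parcs grid_graph" if "(x, y) \<in> parcs grid_graph" for x y
    using that by (cases x; cases y) (auto simp: grid_graph_def mirror_def)
  moreover have "inj_on mirror A" for A
    by (rule inj_on_inverseI[of _ mirror]) simp
  ultimately show ?thesis
    using assms unfolding is_grid_path_iff
    by (auto simp: hd_map last_map distinct_map successively_map elim!: successively_mono)
qed

text \<open>
  Unless \<open>p\<close> and \<open>q\<close> lie on a common axis-parallel line, exactly one of the four sets is nonempty.
\<close>

definition digital_segment :: "int \<times> int \<Rightarrow> int \<times> int \<Rightarrow> (int \<times> int) set" where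
  "digital_segment p q = rising_segment p q \<union> rising_segment q p \<union>
     mirror ` (rising_segment (mirror p) (mirror q) \<union> rising_segment (mirror q) (mirror p))"

lemma digital_segment_commute: "digital_segment p q = digital_segment q p"
  unfolding digital_segment_def by blast

lemma digital_segment_mirror: "digital_segment (mirror p) (mirror q) = mirror ` digital_segment p q"
  unfolding digital_segment_def by (auto simp: mem_mirror_image)

text \<open>Another orientation can contribute points only if \<open>p = q\<close> or the two lie on
  a common vertical or horizontal line, and then these points are already in the rising
  segment.\<close>

lemma digital_segment_rising:
  assumes "below p q"
  shows "digital_segment p q = rising_segment p q"
proof -
  have "r \<in> rising_segment p q" if "r \<in> digital_segment p q" for r
  proof -
    from that consider "r \<in> rising_segment p q" | "r \<in> rising_segment q p"
      | "mirror r \<in> rising_segment (mirror p) (mirror q)"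
      | "mirror r \<in> rising_segment (mirror q) (mirror p)"
      unfolding digital_segment_def by (auto simp: mem_mirror_image)
    then show ?thesis
    proof cases
      case 2
      then have "p = q"
        using rising_segment_below[OF 2] assms by (auto simp: prod_eq_iff)
      then show ?thesis
        using 2 by simp
    next
      case 3
      from rising_segment_below[OF 3] assms show ?thesis
        by (intro rising_segment_vertical) auto
    next
      case 4
      from rising_segment_below[OF 4] assms show ?thesis
        by (intro rising_segment_horizontal) auto
    qed
  qed
  then show ?thesis
    unfolding digital_segment_def by blast
qed

lemma digital_segment_falling: "below q p \<Longrightarrow> digital_segment p q = rising_segment q p"
  using digital_segment_rising digital_segment_commute by blast

text \<open>Either the pair or its mirror image is comparable under \<open>below\<close>, so a claim
  that is stable under reflection needs proof for comparable pairs only.\<close>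

lemma grid_pair_cases [case_names rising falling mirrored]:
  assumes rising: "\<And>p q. below p q \<Longrightarrow> P p q"
    and falling: "\<And>p q. below q p \<Longrightarrow> P p q"
    and mirrored: "\<And>p q. P (mirror p) (mirror q) \<Longrightarrow> P p q"
  shows "P p q"
proof -
  consider "below p q" | "below q p" | "below (mirror p) (mirror q)" | "below (mirror q) (mirror p)"
    by fastforce
  then show ?thesis
    using assms by cases blast+
qed

lemma cds_digital_segment: "cds digital_segment"
proof
  show "{p, q} \<subseteq> digital_segment p q" for p q
  proof (induction p q rule: grid_pair_cases)
    case (mirrored p q)
    then show ?case
      by (simp add: digital_segment_mirror mem_mirror_image)
  qed (simp_all add: digital_segment_rising digital_segment_falling rising_segment_endpoints)
  show "\<exists>w. is_grid_path p w q \<and> digital_segment p q = set w" for p q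
  proof (induction p q rule: grid_pair_cases)
    case (rising p q)
    then show ?case
      using rising_segment_path by (simp add: digital_segment_rising)
  next
    case (falling p q)
    then show ?case
      using rising_segment_path is_grid_path_rev by (metis digital_segment_falling set_rev)
  next
    case (mirrored p q)
    then obtain w where w: "is_grid_path (mirror p) w (mirror q)" "mirror ` digital_segment p q = set w"
      by (auto simp: digital_segment_mirror)
    from is_grid_path_mirror[OF w(1)] have "is_grid_path p (map mirror w) q"
      by simp
    moreover have "digital_segment p q = set (map mirror w)"
      by (simp flip: w(2) add: image_image)
    ultimately show ?case
      by blast
  qed
  show "digital_segment p q = digital_segment q p" for p q
    by (rule digital_segment_commute)
  show "digital_segment p r \<subseteq> digital_segment p q" if "r \<in> digital_segment p q" for p q r
    using that
  proof (induction p q arbitrary: r rule: grid_pair_cases)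
    case (rising p q)
    then have "r \<in> rising_segment p q"
      by (simp add: digital_segment_rising)
    then show ?case
      using rising rising_segment_below(1) rising_segment_prefix by (metis digital_segment_rising)
  next
    \<comment> \<open>The rising path runs from \<open>q\<close> to \<open>p\<close>, so the part
      between \<open>r\<close> and \<open>p\<close> is a suffix of it.\<close>
    case (falling p q)
    then have "r \<in> rising_segment q p"
      by (simp add: digital_segment_falling)
    then show ?case
      using falling rising_segment_below(2) rising_segment_suffix by (metis digital_segment_falling)
  next
    case (mirrored p q)
    from mirrored(1)[of "mirror r"] mirrored(2) show ?case
      by (simp add: digital_segment_mirror mem_mirror_image mirror_image_subset_iff)
  qed
  show "\<exists>r. r \<notin> digital_segment p q \<and> digital_segment p q \<subseteq> digital_segment p r" for p q
  proof (induction p q rule: grid_pair_cases)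
    case (rising p q)
    obtain r where r: "r \<notin> rising_segment p q" "q \<in> rising_segment p r"
      using rising_segment_extend_end[OF rising] .
    moreover have "below p r"
      using rising_segment_below[OF r(2)] by auto
    ultimately show ?case
      using rising rising_segment_prefix by (metis digital_segment_rising)
  next
    \<comment> \<open>Here \<open>q\<close> is the lower end, so prolonging beyond \<open>q\<close>
      means adding a step at the start of the rising path.\<close>
    case (falling p q)
    obtain r where r: "r \<notin> rising_segment q p" "q \<in> rising_segment r p"
      using rising_segment_extend_start[OF falling] .
    moreover have "below r p"
      using rising_segment_below[OF r(2)] by auto
    ultimately show ?case
      using falling rising_segment_suffix by (metis digital_segment_falling)
  next
    case (mirrored p q)
    then obtain r where "r \<notin> digital_segment (mirror p) (mirror q)"
      "digital_segment (mirror p) (mirror q) \<subseteq> digital_segment (mirror p) (mirror (mirror r))"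
      by auto
    then have "mirror r \<notin> digital_segment p q" "digital_segment p q \<subseteq> digital_segment p (mirror r)"
      unfolding digital_segment_mirror by (simp_all add: mem_mirror_image mirror_image_subset_iff)
    then show ?case
      by blast
  qed
  \<comment> \<open>S5 follows from staying in the bounding box of the endpoints, which degenerates
    to a part of the line if they share a coordinate.\<close>
  have in_box: "(fst r \<in> {fst p..fst q} \<or> fst r \<in> {fst q..fst p}) \<and>
      (snd r \<in> {snd p..snd q} \<or> snd r \<in> {snd q..snd p})" if "r \<in> digital_segment p q" for p q r
    using that rising_segment_below[of r p q] rising_segment_below[of r q p]
      rising_segment_below[of "mirror r" "mirror p" "mirror q"]
      rising_segment_below[of "mirror r" "mirror q" "mirror p"]
    unfolding digital_segment_def by (auto simp: mem_mirror_image)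
  show "digital_segment p q \<subseteq> {r. fst r = fst p}" if "fst p = fst q" for p q
    using in_box[of _ p q] that by (intro subsetI CollectI) fastforce
  show "digital_segment p q \<subseteq> {r. snd r = snd p}" if "snd p = snd q" for p q
    using in_box[of _ p q] that by (intro subsetI CollectI) fastforce
qed

section \<open>The Hausdorff distance\<close>

text \<open>Closeness in the maximum norm to the point of the Euclidean segment with parameter
  \<open>t\<close>. Coordinatewise bounds are easy to carry through swapping and reflection.\<close>

definition near_at :: "real \<Rightarrow> int \<times> int \<Rightarrow> int \<times> int \<Rightarrow> int \<times> int \<Rightarrow> real \<Rightarrow> bool" where
  "near_at \<delta> p q r t \<longleftrightarrow> \<bar>fst r - ((1 - t) * fst p + t * fst q)\<bar> \<le> \<delta> \<and>
     \<bar>snd r - ((1 - t) * snd p + t * snd q)\<bar> \<le> \<delta>"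

definition near_segment :: "real \<Rightarrow> int \<times> int \<Rightarrow> int \<times> int \<Rightarrow> (int \<times> int) set \<Rightarrow> bool" where
  "near_segment \<delta> p q A \<longleftrightarrow> (\<forall>r\<in>A. \<exists>t\<in>{0..1}. near_at \<delta> p q r t) \<and>
     (\<forall>t\<in>{0..1}. \<exists>r\<in>A. near_at \<delta> p q r t)"

lemma near_segment_commute:
  assumes "near_segment \<delta> p q A"
  shows "near_segment \<delta> q p A"
proof -
  have flip: "near_at \<delta> q p r (1 - t) \<longleftrightarrow> near_at \<delta> p q r t" for r t
    by (simp add: near_at_def add.commute)
  show ?thesis
    unfolding near_segment_def
  proof (intro conjI ballI)
    fix r assume "r \<in> A"
    then obtain t where "t \<in> {0..1}" "near_at \<delta> p q r t"
      using assms unfolding near_segment_def by blast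
    then show "\<exists>t\<in>{0..1}. near_at \<delta> q p r t"
      by (intro bexI[of _ "1 - t"]) (simp_all add: flip)
  next
    fix t :: real assume "t \<in> {0..1}"
    then have "1 - t \<in> {0..1}"
      by simp
    then obtain r where "r \<in> A" "near_at \<delta> p q r (1 - t)"
      using assms unfolding near_segment_def by blast
    then show "\<exists>r\<in>A. near_at \<delta> q p r t"
      using flip[of r "1 - t"] by auto
  qed
qed

lemma near_segment_mirror:
  assumes "near_segment \<delta> (mirror p) (mirror q) (mirror ` A)"
  shows "near_segment \<delta> p q A"
proof -
  have "near_at \<delta> (mirror p) (mirror q) (mirror r) t \<longleftrightarrow> near_at \<delta> p q r t" for r t
  proof -
    have "- real_of_int (fst r) - ((1 - t) * - fst p + t * - fst q) = - (fst r - ((1 - t) * fst p + t * fst q))"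
      by (simp add: algebra_simps)
    then show ?thesis
      unfolding near_at_def mirror_simps of_int_minus by (simp only: abs_minus_cancel)
  qed
  then show ?thesis
    using assms by (simp add: near_segment_def)
qed

text \<open>The Euclidean distance is at most the sum of the two coordinate errors, hence the factor
  2. Nonemptiness is what allows bounding the suprema pointwise.\<close>

lemma hausdorff_distance_near_segment:
  assumes "near_segment \<delta> p q A" "A \<noteq> {}"
  shows "hausdorff_distance (euclidean_segment p q) (real_point ` A) \<le> 2 * \<delta>"
proof -
  define x where "x t = (1 - t) *\<^sub>R real_point p + t *\<^sub>R real_point q" for t
  have dist: "dist (real_point r) (x t) \<le> 2 * \<delta>" if "near_at \<delta> p q r t" for r t
  proof -
    have "dist (real_point r) (x t) \<le> dist (fst (real_point r)) (fst (x t)) + dist (snd (real_point r)) (snd (x t))"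
      unfolding dist_prod_def by (rule sqrt_sum_squares_le_sum) simp_all
    also have "\<dots> \<le> \<delta> + \<delta>"
      using that by (intro add_mono) (simp_all add: near_at_def x_def real_point_def dist_real_def)
    finally show ?thesis
      by simp
  qed
  have seg: "euclidean_segment p q = x ` {0..1}"
    by (auto simp: closed_segment_def x_def image_iff)
  have "(SUP a\<in>euclidean_segment p q. infdist a (real_point ` A)) \<le> 2 * \<delta>"
  proof (rule cSUP_least)
    fix a assume "a \<in> euclidean_segment p q"
    then obtain t where t: "t \<in> {0..1}" "a = x t"
      unfolding seg by blast
    then obtain r where "r \<in> A" "near_at \<delta> p q r t"
      using assms(1) unfolding near_segment_def by blast
    then show "infdist a (real_point ` A) \<le> 2 * \<delta>"
      using infdist_le2[of "real_point r" "real_point ` A" a] dist[of r t] t by (simp add: dist_commute)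
  qed simp
  moreover have "(SUP b\<in>real_point ` A. infdist b (euclidean_segment p q)) \<le> 2 * \<delta>"
  proof (rule cSUP_least)
    fix b assume "b \<in> real_point ` A"
    then obtain r where r: "r \<in> A" "b = real_point r"
      by blast
    then obtain t where "t \<in> {0..1}" "near_at \<delta> p q r t"
      using assms(1) unfolding near_segment_def by blast
    then show "infdist b (euclidean_segment p q) \<le> 2 * \<delta>"
      using infdist_le2[of "x t" "euclidean_segment p q" b] dist[of r t] r by (simp add: seg)
  qed (use assms(2) in simp)
  ultimately show ?thesis
    by (simp add: hausdorff_distance_def)
qed

text \<open>The point on the \<open>m\<close>-th antidiagonal after \<open>p\<close> is compared
  with the parameter m / n: the discrepancy gives 2 * K, and rounding \<open>t\<close> to a multiple
  of 1 / n gives the additional 1.\<close>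

lemma near_segment_rising:
  assumes "below p q" "p \<noteq> q" "level q - level p < 2 ^ K"
  shows "near_segment (2 * real K + 1) p q (rising_segment p q)"
proof -
  obtain \<theta> where \<theta>: "snd q = snd p + up_count \<theta> (level p) (level q)"
    using rising_segment_threshold[OF assms(1)] .
  define n where "n = level q - level p"
  have n: "0 < n" "n < 2 ^ K" "level q = level p + n"
    using assms by (auto simp: n_def prod_eq_iff)
  define u where "u m = up_count \<theta> (level p) (level p + m)" for m
  have q: "snd q = snd p + u n" "fst q = fst p + n - u n"
    using \<theta> n(3) by (simp_all add: u_def)
  have u_n: "0 \<le> u n" "u n \<le> n"
    using up_count_nonneg up_count_le[of "level p" "level p + n" \<theta>] n by (simp_all add: u_def)
  have u: "\<bar>u m - m / n * u n\<bar> \<le> 2 * real K" if "0 \<le> m" "m \<le> n" for m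
    unfolding u_def using up_count_discrepancy[of m n K \<theta> "level p"] that n by simp
  have near: "near_at (2 * real K + 1) p q (fst p + m - u m, snd p + u m) t"
    if m: "0 \<le> m" "m \<le> n" and t: "m \<le> t * n" "t * n \<le> m + 1" for m :: int and t :: real
  proof -
    define e where "e = t - m / n"
    have e_n: "e * n = t * n - m"
      using n(1) by (simp add: e_def left_diff_distrib)
    have e: "0 \<le> e" "e * n \<le> 1"
      using t n(1) e_n by (simp_all add: e_def pos_divide_le_eq)
    have "e * u n \<le> e * n" "e * (n - u n) \<le> e * n" "0 \<le> e * u n" "0 \<le> e * (n - u n)"
      using e u_n by (auto intro!: mult_left_mono)
    then have en: "\<bar>e * u n\<bar> \<le> 1" "\<bar>e * (n - u n)\<bar> \<le> 1"
      using e(2) by linarith+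
    have "t = m / n + e"
      by (simp add: e_def)
    then have 1: "snd p + u m - ((1 - t) * snd p + t * snd q) = (u m - m / n * u n) - e * u n"
      unfolding q by (simp add: algebra_simps)
    \<comment> \<open>The coordinates of the path point sum to its level, so the discrepancy enters
      the first coordinate with the opposite sign.\<close>
    have 2: "fst p + m - u m - ((1 - t) * fst p + t * fst q) = - (u m - m / n * u n) - e * (n - u n)"
      unfolding q using \<open>t = m / n + e\<close> e_n by (simp add: algebra_simps)
    have bound: "\<bar>x - y\<bar> \<le> 2 * real K + 1 \<and> \<bar>- x - y\<bar> \<le> 2 * real K + 1"
      if "\<bar>x\<bar> \<le> 2 * real K" "\<bar>y\<bar> \<le> 1" for x y :: real
      using that by linarith
    show ?thesis
      using bound[OF u[OF m] en(1)] bound[OF u[OF m] en(2)]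
      unfolding near_at_def fst_conv snd_conv 1 2 by blast
  qed
  have mem: "r \<in> rising_segment p q \<longleftrightarrow> (\<exists>m. 0 \<le> m \<and> m \<le> n \<and> r = (fst p + m - u m, snd p + u m))" for r
  proof
    assume "r \<in> rising_segment p q"
    then show "\<exists>m. 0 \<le> m \<and> m \<le> n \<and> r = (fst p + m - u m, snd p + u m)"
      unfolding rising_segment_iff[OF \<theta>] u_def n(3)
      by (intro exI[of _ "level r - level p"]) (simp add: prod_eq_iff)
  next
    assume "\<exists>m. 0 \<le> m \<and> m \<le> n \<and> r = (fst p + m - u m, snd p + u m)"
    then obtain m where m: "0 \<le> m" "m \<le> n" "r = (fst p + m - u m, snd p + u m)"
      by blast
    moreover from m(3) have "level r = level p + m"
      by simp
    ultimately show "r \<in> rising_segment p q"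
      unfolding rising_segment_iff[OF \<theta>] n(3) by (simp only: u_def snd_conv) simp
  qed
  show ?thesis
    unfolding near_segment_def
  proof (intro conjI ballI)
    fix r assume "r \<in> rising_segment p q"
    then obtain m where m: "0 \<le> m" "m \<le> n" "r = (fst p + m - u m, snd p + u m)"
      unfolding mem by blast
    then have "near_at (2 * real K + 1) p q r (m / n)"
      using near[of m "m / n"] n(1) by simp
    then show "\<exists>t\<in>{0..1}. near_at (2 * real K + 1) p q r t"
      using m n(1) by (intro bexI[of _ "m / n"]) simp_all
  next
    fix t :: real assume t: "t \<in> {0..1}"
    define m where "m = \<lfloor>t * n\<rfloor>"
    have "t * n \<le> n"
      using t n(1) by (simp add: mult_left_le_one_le)
    then have m: "0 \<le> m" "m \<le> n"
      using t n(1) \<open>t * n \<le> n\<close> floor_mono[OF \<open>t * n \<le> n\<close>] by (simp_all add: m_def)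
    have "near_at (2 * real K + 1) p q (fst p + m - u m, snd p + u m) t"
      using m by (intro near) (simp_all add: m_def real_of_int_floor_add_one_ge)
    moreover have "(fst p + m - u m, snd p + u m) \<in> rising_segment p q"
      unfolding mem using m by blast
    ultimately show "\<exists>r\<in>rising_segment p q. near_at (2 * real K + 1) p q r t"
      by blast
  qed
qed

lemma near_segment_digital_segment:
  assumes "p \<noteq> q" "\<bar>fst q - fst p\<bar> + \<bar>snd q - snd p\<bar> < 2 ^ K"
  shows "near_segment (2 * real K + 1) p q (digital_segment p q)"
  using assms
proof (induction p q rule: grid_pair_cases)
  case (rising p q)
  then show ?case
    using near_segment_rising[of p q K] by (simp add: digital_segment_rising)
next
  case (falling p q)
  then show ?case
    using near_segment_rising[of q p K] by (auto simp: digital_segment_falling intro!: near_segment_commute)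
next
  case (mirrored p q)
  have "mirror p \<noteq> mirror q"
    using mirrored(2) by (metis mirror_simps(3))
  moreover have "\<bar>fst (mirror q) - fst (mirror p)\<bar> + \<bar>snd (mirror q) - snd (mirror p)\<bar> < 2 ^ K"
    using mirrored(3) by simp
  ultimately show ?case
    using mirrored(1) near_segment_mirror unfolding digital_segment_mirror by blast
qed

lemma small_hausdorff_distance_digital_segment: "small_hausdorff_distance digital_segment"
  unfolding small_hausdorff_distance_def
proof (intro exI conjI allI impI)
  \<comment> \<open>With l = log 2 d the bound is 4 * K + 2 \<le> 4 * l + 10 \<le> 14 * l. The last
    inequality needs l \<ge> 1, that is, d \<ge> 2; the division by \<open>ln 2\<close> converts the
    base of the logarithm.\<close>
  show "0 < 14 / ln (2 :: real)" "0 < (2 :: real)"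
    by simp_all
  fix p q assume len: "2 \<le> euclidean_length p q"
  define d where "d = euclidean_length p q"
  define n where "n = \<bar>fst q - fst p\<bar> + \<bar>snd q - snd p\<bar>"
  have d: "2 \<le> d"
    using len by (simp add: d_def)
  then have "p \<noteq> q"
    by (auto simp: d_def)
  then have n: "1 \<le> n"
    by (auto simp: n_def prod_eq_iff)
  have "real_of_int n \<le> 2 * d"
    using dist_fst_le[of "real_point p" "real_point q"] dist_snd_le[of "real_point p" "real_point q"]
    by (simp add: n_def d_def real_point_def dist_real_def abs_minus_commute)
  \<comment> \<open>The number of binary digits of \<open>n\<close>, so that n < 2 ^ K.\<close>
  define K where "K = Suc (nat \<lfloor>log 2 n\<rfloor>)"
  have "0 \<le> log 2 n"
    using n by simp
  then have K: "log 2 n < K" "K \<le> log 2 n + 1"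
    unfolding K_def by linarith+
  have "real_of_int n < 2 ^ K"
    using K(1) n by (simp add: log_less_iff powr_realpow)
  then have "n < 2 ^ K"
    by (metis of_int_less_iff of_int_numeral of_int_power)
  then have "hausdorff_distance (euclidean_segment p q) (real_point ` digital_segment p q) \<le> 2 * (2 * real K + 1)"
    using \<open>p \<noteq> q\<close> cds.endpoints[OF cds_digital_segment, of p q]
    by (intro hausdorff_distance_near_segment near_segment_digital_segment) (auto simp: n_def)
  also have "\<dots> \<le> 14 * log 2 d"
  proof -
    have "log 2 n \<le> log 2 (2 * d)"
      using n d \<open>real_of_int n \<le> 2 * d\<close> by simp
    also have "\<dots> = 1 + log 2 d"
      using d by (simp add: log_mult)
    finally have "K \<le> 2 + log 2 d"
      using K(2) by simp
    moreover have "1 \<le> log 2 d"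
      using d by simp
    moreover have "2 * (2 * real K + 1) \<le> 14 * l" if "K \<le> 2 + l" "1 \<le> l" for l :: real
      using that by simp
    ultimately show ?thesis
      by blast
  qed
  finally show "hausdorff_distance (euclidean_segment p q) (real_point ` digital_segment p q)
      \<le> 14 / ln 2 * ln (euclidean_length p q)"
    by (simp add: log_def d_def)
qed

theorem theorem2:
  shows "\<exists>S. cds S \<and> small_hausdorff_distance S"
  using cds_digital_segment small_hausdorff_distance_digital_segment by blast

end
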